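(* Let $\mathcal K$, $P_J$, $f_0$, $f_m$ and $\tilde f_{m,J}$ be as defined in the context. Then for every $1\le m\le M$ and every $J\ge 0$, $$\|\tilde f_{m,J}-f_m\|\le \big\|(P_J\mathcal K)^m-\mathcal K^m\big\|\,\|f_0\|,$$ where the first factor on the right is the operator norm on $L^2([0,1])$, and $$\lim_{J\to\infty}\big\|(P_J\mathcal K)^m-\mathcal K^m\big\|=0 .$$ In particular, $\|\tilde f_{m,J}-f_m\|\to 0$ as $J\to\infty$.
   Context: Parameters: $\hat r\in\mathbb R$, $\sigma>0$, $0<L<U$, $E>0$, $T>0$, an integer $M\ge1$, and $\tau=T/M$. Put $\mu=\hat r-\sigma^2/2$, $\alpha=-\mu/\sigma^2$, $c^2=\sigma^2/2$, $\theta=\ln(U/L)$, $E^*=\ln(E/L)$, $\delta=\max\{E^*,0\}$. $L^2([0,1])$ is the real Hilbert space with inner product $\langle f,g\rangle=\int_0^1 f(x)g(x)\,dx$ and norm $\|\cdot\|$. Kernel: $\kappa(z,\tau)=\dfrac{\theta}{\sqrt{4\pi c^2\tau}}\,e^{-(\theta z)^2/(4c^2\tau)}$. Integral operator $\mathcal K:L^2([0,1])\to L^2([0,1])$: $\mathcal K(f)(z)=\int_0^1\kappa(z-\xi,\tau)f(\xi)\,d\xi$. Initial function: $f_0(z)=L e^{-\alpha\theta z}\,(e^{\theta z}-e^{E^*})\,\mathbf 1_{\{\delta/\theta\le z\le1\}}$ on $[0,1]$. Recursion: $f_m=\mathcal K f_{m-1}$ for $1\le m\le M$. Fix an integer $r\ge1$.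 For $J\ge0$, $V_J\subset L^2([0,1])$ is the $r2^J$-dimensional space of functions whose restriction to each interval $[2^{-J}(i-1),2^{-J}i)$, $1\le i\le 2^J$, is a polynomial of degree less than $r$. $P_J:L^2([0,1])\to V_J$ is the orthogonal projection onto $V_J$. Approximations: $\tilde f_{1,J}=P_J\mathcal K(f_0)$ and $\tilde f_{m,J}=P_J\mathcal K(\tilde f_{m-1,J})$ for $m\ge2$, where $(P_J\mathcal K)(f)=P_J(\mathcal K(f))$. *)

theory Defs
  imports "HOL-Analysis.Analysis" "HOL-Computational_Algebra.Polynomial"
begin

section \<open>The real inner product space of square-integrable functions on the unit interval\<close>

abbreviation unit_leb :: "real measure" where
  "unit_leb \<equiv> lebesgue_on {0..1}"

definition sq_integrable :: "(real \<Rightarrow> real) \<Rightarrow> bool" where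
  "sq_integrable f \<longleftrightarrow> f \<in> borel_measurable unit_leb \<and> integrable unit_leb (\<lambda>x. (f x)\<^sup>2)"

definition ae_eq :: "(real \<Rightarrow> real) \<Rightarrow> (real \<Rightarrow> real) \<Rightarrow> bool" where
  "ae_eq f g \<longleftrightarrow> sq_integrable f \<and> sq_integrable g \<and> (AE x in unit_leb. f x = g x)"

lemma sq_integrable_measurable [measurable_dest]:
  "sq_integrable f \<Longrightarrow> f \<in> borel_measurable unit_leb"
  by (simp add: sq_integrable_def)

lemma sq_integrable_mult:
  assumes "sq_integrable f" "sq_integrable g"
  shows "integrable unit_leb (\<lambda>x. f x * g x)"
proof (rule Bochner_Integration.integrable_bound)
  show "integrable unit_leb (\<lambda>x. (f x)\<^sup>2 + (g x)\<^sup>2)"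
    using assms by (auto simp: sq_integrable_def)
  show "(\<lambda>x. f x * g x) \<in> borel_measurable unit_leb"
    using assms by (auto simp: sq_integrable_def)
  show "AE x in unit_leb. norm (f x * g x) \<le> norm ((f x)\<^sup>2 + (g x)\<^sup>2)"
  proof (intro AE_I2)
    fix x
    have "0 \<le> (\<bar>f x\<bar> - \<bar>g x\<bar>)\<^sup>2" "0 \<le> (f x)\<^sup>2" "0 \<le> (g x)\<^sup>2" by auto
    moreover have "2 * \<bar>f x * g x\<bar> = (f x)\<^sup>2 + (g x)\<^sup>2 - (\<bar>f x\<bar> - \<bar>g x\<bar>)\<^sup>2"
      by (simp add: power2_diff abs_mult)
    ultimately have "\<bar>f x * g x\<bar> \<le> (f x)\<^sup>2 + (g x)\<^sup>2"
      by linarith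
    then show "norm (f x * g x) \<le> norm ((f x)\<^sup>2 + (g x)\<^sup>2)"
      by simp
  qed
qed

lemma sq_integrable_add:
  assumes "sq_integrable f" "sq_integrable g"
  shows "sq_integrable (\<lambda>x. f x + g x)"
proof -
  have "integrable unit_leb (\<lambda>x. (f x)\<^sup>2 + (g x)\<^sup>2 + 2 * (f x * g x))"
    using assms sq_integrable_mult[OF assms] by (auto simp: sq_integrable_def)
  then show ?thesis
    using assms by (auto simp: sq_integrable_def power2_sum mult.assoc)
qed

lemma sq_integrable_scale:
  "sq_integrable f \<Longrightarrow> sq_integrable (\<lambda>x. c * f x)"
  by (auto simp: sq_integrable_def power_mult_distrib)

lemma sq_integrable_bounded:
  assumes "f \<in> borel_measurable unit_leb" "\<And>x. x \<in> {0..1} \<Longrightarrow> \<bar>f x\<bar> \<le> B"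
  shows "sq_integrable f"
proof -
  have "integrable unit_leb (\<lambda>x. (f x)\<^sup>2)"
  proof (rule Bochner_Integration.integrable_bound[of _ "\<lambda>x. B\<^sup>2"])
    show "integrable unit_leb (\<lambda>x. B\<^sup>2)"
      by (intro finite_measure.integrable_const finite_measureI)
         (simp add: emeasure_restrict_space space_restrict_space)
    show "AE x in unit_leb. norm ((f x)\<^sup>2) \<le> norm (B\<^sup>2)"
    proof (intro AE_I2)
      fix x assume "x \<in> space unit_leb"
      then have "\<bar>f x\<bar> \<le> B" using assms(2) by (simp add: space_restrict_space)
      then have "\<bar>f x\<bar>\<^sup>2 \<le> B\<^sup>2" by (intro power_mono) auto
      then show "norm ((f x)\<^sup>2) \<le> norm (B\<^sup>2)" by simp
    qed
  qed (use assms in auto)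
  with assms show ?thesis by (simp add: sq_integrable_def)
qed

lemma sq_integrable_zero: "sq_integrable (\<lambda>x. 0)"
  by (rule sq_integrable_bounded[of _ 0]) auto

lemma continuous_interval_bounded:
  fixes f :: "real \<Rightarrow> real"
  assumes "continuous_on {a..b} f"
  shows "\<exists>B. \<forall>x\<in>{a..b}. \<bar>f x\<bar> \<le> B"
proof -
  have "bounded (f ` {a..b})"
    using assms by (intro compact_imp_bounded compact_continuous_image) auto
  then show ?thesis by (auto simp: bounded_iff)
qed

lemma sq_integrable_continuous:
  assumes "continuous_on {0..1} f"
  shows "sq_integrable f"
proof -
  obtain B where "\<And>x. x \<in> {0..1} \<Longrightarrow> \<bar>f x\<bar> \<le> B"
    using continuous_interval_bounded[OF assms] by metis
  moreover have "f \<in> borel_measurable unit_leb"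
    using assms by (intro continuous_imp_measurable_on_sets_lebesgue) auto
  ultimately show ?thesis
    using sq_integrable_bounded by blast
qed

lemma sq_integrable_imp_integrable:
  assumes "sq_integrable f"
  shows "integrable unit_leb f"
  using sq_integrable_mult[OF sq_integrable_bounded[of "\<lambda>x. 1" 1] assms] by auto

quotient_type L2 = "real \<Rightarrow> real" / partial: ae_eq
  morphisms rep_L2 abs_L2
proof (rule part_equivpI)
  show "\<exists>f. ae_eq f f"
    using sq_integrable_zero by (auto simp: ae_eq_def)
  show "symp ae_eq"
    by (auto intro!: sympI simp: ae_eq_def elim: eventually_mono)
  show "transp ae_eq"
    by (intro transpI) (auto simp: ae_eq_def elim: eventually_elim2)
qed

instantiation L2 :: real_inner
begin

lift_definition zero_L2 :: L2 is "\<lambda>x. 0"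
  by (simp add: ae_eq_def sq_integrable_zero)

lift_definition plus_L2 :: "L2 \<Rightarrow> L2 \<Rightarrow> L2" is "\<lambda>f g x. f x + g x"
  by (auto simp: ae_eq_def intro!: sq_integrable_add elim: eventually_elim2)

lift_definition scaleR_L2 :: "real \<Rightarrow> L2 \<Rightarrow> L2" is "\<lambda>c f x. c * f x"
  by (auto simp: ae_eq_def intro!: sq_integrable_scale elim: eventually_mono)

definition uminus_L2 :: "L2 \<Rightarrow> L2" where
  "uminus_L2 f = (-1) *\<^sub>R f"

definition minus_L2 :: "L2 \<Rightarrow> L2 \<Rightarrow> L2" where
  "minus_L2 f g = f + - g"

lift_definition inner_L2 :: "L2 \<Rightarrow> L2 \<Rightarrow> real" is
  "\<lambda>f g. \<integral>x. f x * g x \<partial>unit_leb"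
  by (rule integral_cong_AE)
     (auto simp: ae_eq_def sq_integrable_def elim: eventually_elim2)

definition norm_L2 :: "L2 \<Rightarrow> real" where
  "norm_L2 f = sqrt (inner f f)"

definition dist_L2 :: "L2 \<Rightarrow> L2 \<Rightarrow> real" where
  "dist_L2 f g = norm (f - g)"

definition sgn_L2 :: "L2 \<Rightarrow> L2" where
  "sgn_L2 f = inverse (norm f) *\<^sub>R f"

definition uniformity_L2 :: "(L2 \<times> L2) filter" where
  "uniformity_L2 = (INF e\<in>{0<..}. principal {(x, y). dist x y < e})"

definition open_L2 :: "L2 set \<Rightarrow> bool" where
  "open_L2 S \<longleftrightarrow> (\<forall>x\<in>S. \<forall>\<^sub>F (x', y) in uniformity. x' = x \<longrightarrow> y \<in> S)"

instance
proof
  fix f g h :: L2 and a b :: real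
  show "f + g + h = f + (g + h)"
    by transfer (auto simp: ae_eq_def add.assoc intro!: sq_integrable_add)
  show "f + g = g + f"
    by transfer (auto simp: ae_eq_def add.commute intro!: sq_integrable_add)
  show "0 + f = f"
    by transfer (auto simp: ae_eq_def)
  show "- f + f = 0"
    unfolding uminus_L2_def
    by transfer (auto simp: ae_eq_def sq_integrable_zero)
  show "f - g = f + - g"
    by (simp add: minus_L2_def)
  show "a *\<^sub>R (f + g) = a *\<^sub>R f + a *\<^sub>R g"
    by transfer (auto simp: ae_eq_def ring_distribs intro!: sq_integrable_add sq_integrable_scale)
  show "(a + b) *\<^sub>R f = a *\<^sub>R f + b *\<^sub>R f"
    by transfer (auto simp: ae_eq_def ring_distribs intro!: sq_integrable_add sq_integrable_scale)
  show "a *\<^sub>R b *\<^sub>R f = (a * b) *\<^sub>R f"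
    by transfer (auto simp: ae_eq_def mult.assoc
        intro!: sq_integrable_scale[where c = "a * b" for a b, simplified mult.assoc] sq_integrable_scale)
  show "1 *\<^sub>R f = f"
    by transfer (auto simp: ae_eq_def)
  show "dist f g = norm (f - g)"
    by (simp add: dist_L2_def)
  show "sgn f = inverse (norm f) *\<^sub>R f"
    by (simp add: sgn_L2_def)
  show "uniformity = (INF e\<in>{0<..}. principal {(x, y :: L2). dist x y < e})"
    by (simp add: uniformity_L2_def)
  show "open S \<longleftrightarrow> (\<forall>x\<in>S. \<forall>\<^sub>F (x', y) in uniformity. x' = x \<longrightarrow> y \<in> S)" for S :: "L2 set"
    by (simp add: open_L2_def)
  show "inner f g = inner g f"
    by transfer (simp add: mult.commute)
  show "inner (f + g) h = inner f h + inner g h"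
    by transfer (auto simp: ae_eq_def ring_distribs sq_integrable_mult intro!: Bochner_Integration.integral_add)
  show "inner (a *\<^sub>R f) g = a * inner f g"
    by transfer (simp add: mult.assoc)
  show "0 \<le> inner f f"
    by transfer simp
  show "inner f f = 0 \<longleftrightarrow> f = 0"
    by transfer
       (auto simp: ae_eq_def sq_integrable_zero sq_integrable_mult integral_nonneg_eq_0_iff_AE)
  show "norm f = sqrt (inner f f)"
    by (simp add: norm_L2_def)
qed

end

section \<open>Orthogonal projection and piecewise polynomials\<close>

definition orth_proj :: "'a::real_inner set \<Rightarrow> 'a \<Rightarrow> 'a" where
  "orth_proj V x = (THE p. p \<in> V \<and> (\<forall>v\<in>V. orthogonal (x - p) v))"

definition piecewise_poly :: "nat \<Rightarrow> nat \<Rightarrow> (real \<Rightarrow> real) \<Rightarrow> bool" where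
  "piecewise_poly r J f \<longleftrightarrow>
     (\<forall>i\<in>{1..2 ^ J}. \<exists>p :: real poly. degree p < r \<and>
        (\<forall>x\<in>{(real i - 1) / 2 ^ J ..< real i / 2 ^ J}. f x = poly p x))"

text \<open>Values at \<open>1\<close> and outside the unit interval are unconstrained, but the class in \<open>L2\<close>
  does not depend on them.\<close>

definition V_space :: "nat \<Rightarrow> nat \<Rightarrow> L2 set" where
  "V_space r J = {abs_L2 f |f. sq_integrable f \<and> piecewise_poly r J f}"

definition P_op :: "nat \<Rightarrow> nat \<Rightarrow> L2 \<Rightarrow> L2" where
  "P_op r J = orth_proj (V_space r J)"

section \<open>The integral operator, the initial function and the recursions\<close>

definition \<mu>_of :: "real \<Rightarrow> real \<Rightarrow> real" where
  "\<mu>_of rh \<sigma> = rh - \<sigma>\<^sup>2 / 2"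

definition \<alpha>_of :: "real \<Rightarrow> real \<Rightarrow> real" where
  "\<alpha>_of rh \<sigma> = - \<mu>_of rh \<sigma> / \<sigma>\<^sup>2"

text \<open>The constant \<open>c\<close> enters only through its square.\<close>

definition csq_of :: "real \<Rightarrow> real" where
  "csq_of \<sigma> = \<sigma>\<^sup>2 / 2"

definition \<theta>_of :: "real \<Rightarrow> real \<Rightarrow> real" where
  "\<theta>_of L U = ln (U / L)"

definition Estar_of :: "real \<Rightarrow> real \<Rightarrow> real" where
  "Estar_of L E = ln (E / L)"

definition \<delta>_of :: "real \<Rightarrow> real \<Rightarrow> real" where
  "\<delta>_of L E = max (Estar_of L E) 0"

definition kern :: "real \<Rightarrow> real \<Rightarrow> real \<Rightarrow> real \<Rightarrow> real \<Rightarrow> real" where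
  "kern \<sigma> L U z \<tau> =
     \<theta>_of L U / sqrt (4 * pi * csq_of \<sigma> * \<tau>) * exp (- (\<theta>_of L U * z)\<^sup>2 / (4 * csq_of \<sigma> * \<tau>))"

lemma kern_continuous [continuous_intros]:
  "continuous_on A g \<Longrightarrow> continuous_on A (\<lambda>z. kern \<sigma> L U (g z) \<tau>)"
  unfolding kern_def divide_inverse by (intro continuous_intros)

lemma kern_bounded:
  "\<exists>B. \<forall>z\<in>{0..1}. \<forall>\<xi>\<in>{0..1}. \<bar>kern \<sigma> L U (z - \<xi>) \<tau>\<bar> \<le> B"
proof -
  have "continuous_on {-1..1} (\<lambda>z. kern \<sigma> L U z \<tau>)"
    by (intro continuous_intros)
  then obtain B where "\<And>z. z \<in> {-1..1} \<Longrightarrow> \<bar>kern \<sigma> L U z \<tau>\<bar> \<le> B"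
    using continuous_interval_bounded by metis
  then show ?thesis by (intro exI[of _ B]) auto
qed

lemma kern_measurable: "(\<lambda>\<xi>. kern \<sigma> L U (z - \<xi>) \<tau>) \<in> borel_measurable unit_leb"
  by (intro continuous_imp_measurable_on_sets_lebesgue continuous_intros) auto

lemma sq_integrable_kern_integral:
  assumes "sq_integrable f"
  shows "sq_integrable (\<lambda>z. \<integral>\<xi>. kern \<sigma> L U (z - \<xi>) \<tau> * f \<xi> \<partial>unit_leb)"
proof (rule sq_integrable_continuous)
  note [measurable] = kern_measurable sq_integrable_measurable[OF assms]
  obtain B where B: "\<And>z \<xi>. z \<in> {0..1} \<Longrightarrow> \<xi> \<in> {0..1} \<Longrightarrow> \<bar>kern \<sigma> L U (z - \<xi>) \<tau>\<bar> \<le> B"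
    using kern_bounded by metis
  show "continuous_on {0..1} (\<lambda>z. \<integral>\<xi>. kern \<sigma> L U (z - \<xi>) \<tau> * f \<xi> \<partial>unit_leb)"
    unfolding continuous_on_sequentially comp_def
  proof (intro allI ballI impI, elim conjE)
    fix X and a :: real
    assume a: "a \<in> {0..1}" and X: "\<forall>n. X n \<in> {0..1}" "X \<longlonglongrightarrow> a"
    show "(\<lambda>n. \<integral>\<xi>. kern \<sigma> L U (X n - \<xi>) \<tau> * f \<xi> \<partial>unit_leb)
        \<longlonglongrightarrow> (\<integral>\<xi>. kern \<sigma> L U (a - \<xi>) \<tau> * f \<xi> \<partial>unit_leb)"
    proof (rule integral_dominated_convergence[where w = "\<lambda>\<xi>. B * \<bar>f \<xi>\<bar>"])
      show "integrable unit_leb (\<lambda>\<xi>. B * \<bar>f \<xi>\<bar>)"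
        using sq_integrable_imp_integrable[OF assms] by auto
      have c: "continuous_on UNIV (\<lambda>z. kern \<sigma> L U z \<tau>)"
        by (intro continuous_intros)
      show "AE \<xi> in unit_leb.
          (\<lambda>n. kern \<sigma> L U (X n - \<xi>) \<tau> * f \<xi>) \<longlonglongrightarrow> kern \<sigma> L U (a - \<xi>) \<tau> * f \<xi>"
        by (intro AE_I2 tendsto_mult tendsto_const continuous_on_tendsto_compose[OF c]
              tendsto_diff X) auto
      show "AE \<xi> in unit_leb. norm (kern \<sigma> L U (X n - \<xi>) \<tau> * f \<xi>) \<le> B * \<bar>f \<xi>\<bar>" for n
        using X(1) by (auto intro!: AE_I2 mult_right_mono B simp: abs_mult space_restrict_space)
    qed auto
  qed
qed

lift_definition K_op :: "real \<Rightarrow> real \<Rightarrow> real \<Rightarrow> real \<Rightarrow> L2 \<Rightarrow> L2" is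
  "\<lambda>\<sigma> L U \<tau> f z. \<integral>\<xi>. kern \<sigma> L U (z - \<xi>) \<tau> * f \<xi> \<partial>unit_leb"
proof -
  fix \<sigma> L U \<tau> :: real and f g :: "real \<Rightarrow> real"
  assume fg: "ae_eq f g"
  then have [measurable]: "f \<in> borel_measurable unit_leb" "g \<in> borel_measurable unit_leb"
    by (auto simp: ae_eq_def sq_integrable_def)
  note [measurable] = kern_measurable
  have "(\<integral>\<xi>. kern \<sigma> L U (z - \<xi>) \<tau> * f \<xi> \<partial>unit_leb) = (\<integral>\<xi>. kern \<sigma> L U (z - \<xi>) \<tau> * g \<xi> \<partial>unit_leb)" for z
    using fg by (intro integral_cong_AE) (auto simp: ae_eq_def elim: eventually_mono)
  then show "ae_eq (\<lambda>z. \<integral>\<xi>. kern \<sigma> L U (z - \<xi>) \<tau> * f \<xi> \<partial>unit_leb)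
                   (\<lambda>z. \<integral>\<xi>. kern \<sigma> L U (z - \<xi>) \<tau> * g \<xi> \<partial>unit_leb)"
    using fg by (auto simp: ae_eq_def intro!: sq_integrable_kern_integral)
qed

definition payoff :: "real \<Rightarrow> real \<Rightarrow> real \<Rightarrow> real \<Rightarrow> real \<Rightarrow> real \<Rightarrow> real" where
  "payoff rh \<sigma> L U E z =
     L * exp (- \<alpha>_of rh \<sigma> * \<theta>_of L U * z) * (exp (\<theta>_of L U * z) - exp (Estar_of L E))
       * indicator {\<delta>_of L E / \<theta>_of L U .. 1} z"

lemma sq_integrable_payoff: "sq_integrable (payoff rh \<sigma> L U E)"
proof -
  define h where "h z = L * exp (- \<alpha>_of rh \<sigma> * \<theta>_of L U * z)
      * (exp (\<theta>_of L U * z) - exp (Estar_of L E))" for z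
  have c: "continuous_on {0..1} h"
    unfolding h_def by (intro continuous_intros)
  obtain B where B: "\<And>x. x \<in> {0..1} \<Longrightarrow> \<bar>h x\<bar> \<le> B"
    using continuous_interval_bounded[OF c] by metis
  have [measurable]: "h \<in> borel_measurable unit_leb"
    using c by (intro continuous_imp_measurable_on_sets_lebesgue) auto
  have "indicat_real {\<delta>_of L E / \<theta>_of L U .. 1} \<in> borel_measurable unit_leb"
    by (intro measurable_restrict_space1 borel_measurable_indicator) auto
  then have "(\<lambda>z. h z * indicator {\<delta>_of L E / \<theta>_of L U .. 1} z) \<in> borel_measurable unit_leb"
    by measurable
  moreover have "\<bar>h z * indicator {\<delta>_of L E / \<theta>_of L U .. 1} z\<bar> \<le> B" if "z \<in> {0..1}" for z
    using B[OF that] by (auto simp: indicator_def)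
  moreover have "payoff rh \<sigma> L U E = (\<lambda>z. h z * indicator {\<delta>_of L E / \<theta>_of L U .. 1} z)"
    by (auto simp: payoff_def h_def)
  ultimately show ?thesis
    by (metis sq_integrable_bounded)
qed

lift_definition f_init :: "real \<Rightarrow> real \<Rightarrow> real \<Rightarrow> real \<Rightarrow> real \<Rightarrow> L2" is payoff
  by (simp add: ae_eq_def sq_integrable_payoff)

primrec f_seq :: "real \<Rightarrow> real \<Rightarrow> real \<Rightarrow> real \<Rightarrow> real \<Rightarrow> real \<Rightarrow> nat \<Rightarrow> L2" where
  "f_seq rh \<sigma> L U E \<tau> 0 = f_init rh \<sigma> L U E"
| "f_seq rh \<sigma> L U E \<tau> (Suc m) = K_op \<sigma> L U \<tau> (f_seq rh \<sigma> L U E \<tau> m)"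

definition PK_op :: "real \<Rightarrow> real \<Rightarrow> real \<Rightarrow> real \<Rightarrow> nat \<Rightarrow> nat \<Rightarrow> L2 \<Rightarrow> L2" where
  "PK_op \<sigma> L U \<tau> r J = P_op r J \<circ> K_op \<sigma> L U \<tau>"

text \<open>Only the indices \<open>m \<ge> 1\<close> of the approximations are meaningful; the value at \<open>m = 0\<close> is
  the unprojected initial function, so that the first approximation is \<open>P\<^sub>J K f\<^sub>0\<close>.\<close>

primrec f_approx ::
  "real \<Rightarrow> real \<Rightarrow> real \<Rightarrow> real \<Rightarrow> real \<Rightarrow> real \<Rightarrow> nat \<Rightarrow> nat \<Rightarrow> nat \<Rightarrow> L2" where
  "f_approx rh \<sigma> L U E \<tau> r J 0 = f_init rh \<sigma> L U E"
| "f_approx rh \<sigma> L U E \<tau> r J (Suc m) = PK_op \<sigma> L U \<tau> r J (f_approx rh \<sigma> L U E \<tau> r J m)"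

end

theory Submission
  imports Defs
begin

text \<open>The kernel is Lipschitz, so by Cauchy--Schwarz \<open>K f\<close> has Lipschitz constant at most
  \<open>C \<parallel>f\<parallel>\<close>. It is therefore within \<open>C 2\<^sup>-\<^sup>J \<parallel>f\<parallel>\<close> of the step function taking its values at the left
  dyadic endpoints, which lies in \<open>V\<^sub>J\<close> since \<open>r \<ge> 1\<close>. As the orthogonal projection is the best
  approximation, \<open>\<parallel>P\<^sub>J K - K\<parallel> \<le> C 2\<^sup>-\<^sup>J\<close>. Since \<open>\<parallel>P\<^sub>J K\<parallel> \<le> \<parallel>K\<parallel>\<close>, telescoping
  \<open>A\<^sup>m - B\<^sup>m\<close> gives \<open>\<parallel>(P\<^sub>J K)\<^sup>m - K\<^sup>m\<parallel> \<le> m \<parallel>K\<parallel>\<^sup>m\<^sup>-\<^sup>1 C 2\<^sup>-\<^sup>J\<close>.\<close>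

section \<open>Orthogonal projections onto finite-dimensional subspaces\<close>

text \<open>One Gram-Schmidt step per generator: the new vector \<open>a\<close> is replaced by its
  residual \<open>e\<close> against \<open>span B\<close>, and the component along \<open>e\<close>
  is added to the old projection of \<open>x\<close>. Existence thus rests on finite dimension
  instead of completeness.\<close>

lemma finite_span_orthogonal_decomp:
  fixes B :: "'a::real_inner set"
  assumes "finite B"
  shows "\<exists>p\<in>span B. \<forall>v\<in>span B. orthogonal (x - p) v"
  using assms
proof (induction B arbitrary: x)
  case empty
  show ?case by (simp add: orthogonal_def)
next
  case (insert a B)
  obtain q where q: "q \<in> span B" "\<And>v. v \<in> span B \<Longrightarrow> (a - q) \<bullet> v = 0"
    using insert.IH[of a] by (auto simp: orthogonal_def)
  obtain p where p: "p \<in> span B" "\<And>v. v \<in> span B \<Longrightarrow> (x - p) \<bullet> v = 0"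
    using insert.IH[of x] by (auto simp: orthogonal_def)
  define e where "e = a - q"
  \<comment> \<open>The Fourier coefficient of \<open>x\<close> along \<open>e\<close>. If
    \<open>a\<close> already lies in \<open>span B\<close>, then \<open>e = 0\<close> and division
    by zero gives \<open>c = 0\<close>, so \<open>c * (e \<bullet> e) = x \<bullet> e\<close> holds
    in that case too.\<close>
  define c where "c = (x \<bullet> e) / (e \<bullet> e)"
  have sub: "span B \<subseteq> span (insert a B)"
    by (intro span_mono) auto
  have "e \<in> span (insert a B)"
    unfolding e_def using sub q(1) by (intro span_diff) (auto intro: span_base)
  then have "p + c *\<^sub>R e \<in> span (insert a B)"
    using sub p(1) by (intro span_add span_scale) auto
  moreover have "(x - (p + c *\<^sub>R e)) \<bullet> v = 0" if v: "v \<in> span (insert a B)" for v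
  proof -
    obtain k where k: "v - k *\<^sub>R a \<in> span B"
      using v by (auto simp: span_breakdown_eq)
    \<comment> \<open>Trading \<open>a\<close> for \<open>e\<close> changes
      \<open>v - k *\<^sub>R a\<close> only by a multiple of \<open>q\<close>. So \<open>v\<close>
      splits into a multiple of \<open>e\<close> and an element of \<open>span B\<close>, which are
      orthogonal to each other.\<close>
    define u where "u = v - k *\<^sub>R e"
    have "u = (v - k *\<^sub>R a) + k *\<^sub>R q"
      by (simp add: u_def e_def scaleR_diff_right)
    then have u: "u \<in> span B"
      using k q(1) by (simp add: span_add span_scale)
    have "e \<bullet> p = 0" "e \<bullet> u = 0" "(x - p) \<bullet> u = 0"
      using q(2) p u by (auto simp: e_def)
    moreover have "c * (e \<bullet> e) = x \<bullet> e"
      by (simp add: c_def)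
    ultimately have "(x - (p + c *\<^sub>R e)) \<bullet> (k *\<^sub>R e + u) = 0"
      by (simp add: inner_diff_left inner_add_left inner_add_right inner_commute[of p e]
          inner_commute[of p u])
    then show ?thesis
      by (simp add: u_def)
  qed
  ultimately show ?case
    unfolding orthogonal_def by blast
qed

text \<open>A maximal independent subset of \<open>V\<close> spans \<open>V\<close> and is finite
  because it sits inside a finite span. It therefore suffices to enclose \<open>V\<close> in such a
  span, without exhibiting a basis.\<close>

lemma subspace_of_finite_span_orthogonal_decomp:
  fixes V :: "'a::real_inner set"
  assumes V: "subspace V" and B: "finite B" "V \<subseteq> span B"
  shows "\<exists>p\<in>V. \<forall>v\<in>V. orthogonal (x - p) v"
proof -
  obtain S where S: "S \<subseteq> V" "independent S" "V \<subseteq> span S"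
    using maximal_independent_subset by blast
  then have "span S = V"
    using V by (simp add: span_subspace)
  moreover have "finite S"
    using independent_span_bound[OF B(1) S(2)] S(1) B(2) by auto
  ultimately show ?thesis
    using finite_span_orthogonal_decomp by metis
qed

section \<open>Uniqueness, contraction and best approximation for the orthogonal projection\<close>

context
  fixes V :: "'a::real_inner set"
  assumes V: "subspace V"
    and ex: "\<And>x. \<exists>p\<in>V. \<forall>v\<in>V. orthogonal (x - p) v"
begin

text \<open>The difference of two candidates lies in \<open>V\<close> and is orthogonal to itself.
  This resolves the definite description in \<open>orth_proj_def\<close>, and later identities for
  projections are checked through it.\<close>

lemma orth_proj_unique:
  assumes p: "p \<in> V" "\<And>v. v \<in> V \<Longrightarrow> orthogonal (x - p) v"
  shows "orth_proj V x = p"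
  unfolding orth_proj_def
proof (rule the_equality)
  fix q assume q: "q \<in> V \<and> (\<forall>v\<in>V. orthogonal (x - q) v)"
  have "p - q \<in> V"
    using V p q by (simp add: subspace_diff)
  then have "(x - q) \<bullet> (p - q) = 0" "(x - p) \<bullet> (p - q) = 0"
    using p q by (auto simp: orthogonal_def)
  then have "(p - q) \<bullet> (p - q) = 0"
    by (simp add: inner_diff_left)
  then show "q = p"
    by simp
qed (use p in auto)

lemma orth_proj_in: "orth_proj V x \<in> V"
  and orth_proj_orthogonal: "v \<in> V \<Longrightarrow> (x - orth_proj V x) \<bullet> v = 0"
proof -
  obtain p where p: "p \<in> V" "\<And>v. v \<in> V \<Longrightarrow> orthogonal (x - p) v"
    using ex[of x] by blast
  then have eq: "orth_proj V x = p"
    by (rule orth_proj_unique)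
  show "orth_proj V x \<in> V"
    using p(1) by (simp only: eq)
  show "v \<in> V \<Longrightarrow> (x - orth_proj V x) \<bullet> v = 0"
    using p(2) by (simp only: eq orthogonal_def)
qed

lemma norm_orth_proj_le: "norm (orth_proj V x) \<le> norm x"
proof -
  have "(norm (orth_proj V x))\<^sup>2 = x \<bullet> orth_proj V x"
    using orth_proj_orthogonal[OF orth_proj_in]
    by (simp add: power2_norm_eq_inner inner_diff_left)
  also have "\<dots> \<le> norm x * norm (orth_proj V x)"
    by (rule norm_cauchy_schwarz)
  finally show ?thesis
    by (cases "orth_proj V x = 0") (simp_all add: power2_eq_square)
qed

text \<open>The residual is orthogonal to \<open>?p - v\<close>, so its squared norm equals its
  inner product with \<open>x - v\<close>; Cauchy-Schwarz then allows one factor to be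
  cancelled.\<close>

lemma norm_minus_orth_proj_le:
  assumes "v \<in> V"
  shows "norm (x - orth_proj V x) \<le> norm (x - v)"
proof -
  let ?p = "orth_proj V x"
  have "?p - v \<in> V"
    using V assms orth_proj_in by (simp add: subspace_diff)
  then have "(norm (x - ?p))\<^sup>2 = (x - ?p) \<bullet> (x - v)"
    using orth_proj_orthogonal[of "?p - v" x]
    by (simp add: power2_norm_eq_inner inner_diff_right)
  also have "\<dots> \<le> norm (x - ?p) * norm (x - v)"
    by (rule norm_cauchy_schwarz)
  finally show ?thesis
    by (cases "x = ?p") (simp_all add: power2_eq_square)
qed

lemma bounded_linear_orth_proj: "bounded_linear (orth_proj V)"
proof (rule bounded_linear_intro)
  show "orth_proj V (x + y) = orth_proj V x + orth_proj V y" for x y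
    using V orth_proj_in[of x] orth_proj_in[of y] orth_proj_orthogonal[of _ x]
      orth_proj_orthogonal[of _ y]
    by (intro orth_proj_unique)
      (auto simp: orthogonal_def subspace_add inner_diff_left inner_add_left)
  show "orth_proj V (c *\<^sub>R x) = c *\<^sub>R orth_proj V x" for c x
    using V orth_proj_in[of x] orth_proj_orthogonal[of _ x]
    by (intro orth_proj_unique)
      (auto simp: orthogonal_def subspace_scale inner_diff_left simp flip: scaleR_diff_right)
  show "norm (orth_proj V x) \<le> norm x * 1" for x
    using norm_orth_proj_le by simp
qed

end

section \<open>Working with representatives\<close>

lemma ae_eq_refl_iff [simp]: "ae_eq f f \<longleftrightarrow> sq_integrable f"
  by (simp add: ae_eq_def)

lemma L2_cases:
  obtains f where "sq_integrable f" "x = abs_L2 f"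
  by (induction x rule: L2.abs_induct) auto

lemma abs_L2_cong:
  assumes "sq_integrable f" "sq_integrable g" "AE x in unit_leb. f x = g x"
  shows "abs_L2 f = abs_L2 g"
  using Quotient3_rel_abs[OF Quotient3_L2] assms by (simp add: ae_eq_def)

lemma abs_L2_add:
  "sq_integrable f \<Longrightarrow> sq_integrable g \<Longrightarrow> abs_L2 f + abs_L2 g = abs_L2 (\<lambda>x. f x + g x)"
  by (simp add: plus_L2.abs_eq)

lemma abs_L2_scaleR: "sq_integrable f \<Longrightarrow> c *\<^sub>R abs_L2 f = abs_L2 (\<lambda>x. c * f x)"
  by (simp add: scaleR_L2.abs_eq)

lemma abs_L2_diff:
  assumes "sq_integrable f" "sq_integrable g"
  shows "abs_L2 f - abs_L2 g = abs_L2 (\<lambda>x. f x - g x)"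
proof -
  have "abs_L2 f - abs_L2 g = abs_L2 f + (-1) *\<^sub>R abs_L2 g"
    by simp
  also have "\<dots> = abs_L2 (\<lambda>x. f x + (-1) * g x)"
    by (simp only: abs_L2_scaleR abs_L2_add assms sq_integrable_scale)
  finally show ?thesis
    by simp
qed

lemma sq_integrable_sum:
  "finite I \<Longrightarrow> (\<And>i. i \<in> I \<Longrightarrow> sq_integrable (f i)) \<Longrightarrow> sq_integrable (\<lambda>x. \<Sum>i\<in>I. f i x)"
  by (induction I rule: finite_induct) (auto simp: sq_integrable_zero sq_integrable_add)

lemma abs_L2_sum:
  "finite I \<Longrightarrow> (\<And>i. i \<in> I \<Longrightarrow> sq_integrable (f i)) \<Longrightarrow>
    abs_L2 (\<lambda>x. \<Sum>i\<in>I. f i x) = (\<Sum>i\<in>I. abs_L2 (f i))"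
proof (induction I rule: finite_induct)
  case empty
  show ?case by (simp add: zero_L2.abs_eq)
next
  case (insert i I)
  then show ?case
    by (simp add: sq_integrable_sum flip: abs_L2_add)
qed

lemma norm_abs_L2: "sq_integrable f \<Longrightarrow> norm (abs_L2 f) = sqrt (\<integral>x. (f x)\<^sup>2 \<partial>unit_leb)"
  by (simp add: norm_eq_sqrt_inner inner_L2.abs_eq power2_eq_square)

lemma measure_unit_leb: "measure unit_leb {0..1} = 1"
  by (simp add: measure_restrict_space)

lemma integrable_const_unit_leb: "integrable unit_leb (\<lambda>x. c :: real)"
  by (rule sq_integrable_imp_integrable, rule sq_integrable_bounded[of _ "\<bar>c\<bar>"]) auto

text \<open>The half-open dyadic intervals cover only \<open>{0..<1}\<close>; the missing endpoint
  is a null set.\<close>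

lemma AE_unit_leb_less_1: "AE x in unit_leb. x \<in> {0..<1}"
proof -
  have "AE x in unit_leb. x \<noteq> 1"
    by (rule AE_I[of _ _ "{1}"]) (auto simp: sets_restrict_space_iff emeasure_restrict_space)
  moreover have "AE x in unit_leb. x \<in> {0..1}"
    by (intro AE_I2) (simp add: space_restrict_space)
  ultimately show ?thesis
    by eventually_elim auto
qed

lemma norm_abs_L2_le:
  assumes "sq_integrable f" "\<And>x. x \<in> {0..<1} \<Longrightarrow> \<bar>f x\<bar> \<le> B"
  shows "norm (abs_L2 f) \<le> B"
proof -
  have B: "0 \<le> B"
    using assms(2)[of 0] by auto
  have "AE x in unit_leb. (f x)\<^sup>2 \<le> B\<^sup>2"
    using AE_unit_leb_less_1
  proof eventually_elim
    case (elim x)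
    show ?case
      using power_mono[OF assms(2)[OF elim] abs_ge_zero, of 2] by simp
  qed
  then have "(\<integral>x. (f x)\<^sup>2 \<partial>unit_leb) \<le> (\<integral>x. B\<^sup>2 \<partial>unit_leb)"
    using assms(1) by (intro integral_mono_AE integrable_const_unit_leb) (auto simp: sq_integrable_def)
  also have "\<dots> = B\<^sup>2"
    by (simp add: measure_unit_leb)
  finally show ?thesis
    using B assms(1) by (simp add: norm_abs_L2 real_le_lsqrt)
qed

text \<open>Cauchy-Schwarz, with the L2 norm of \<open>k\<close> bounded by its supremum because the
  interval has length 1. It is applied to the kernel for boundedness and to differences of kernels
  for the Lipschitz estimate.\<close>

lemma integral_mult_le_norm:
  assumes f: "sq_integrable f" and k: "k \<in> borel_measurable unit_leb"
    and B: "\<And>x. x \<in> {0..1} \<Longrightarrow> \<bar>k x\<bar> \<le> B"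
  shows "\<bar>\<integral>x. k x * f x \<partial>unit_leb\<bar> \<le> B * norm (abs_L2 f)"
proof -
  have "sq_integrable k"
    using k B by (rule sq_integrable_bounded)
  then have "\<bar>\<integral>x. k x * f x \<partial>unit_leb\<bar> = \<bar>abs_L2 k \<bullet> abs_L2 f\<bar>"
    using f by (simp add: inner_L2.abs_eq)
  also have "\<dots> \<le> norm (abs_L2 k) * norm (abs_L2 f)"
    by (rule Cauchy_Schwarz_ineq2)
  also have "\<dots> \<le> B * norm (abs_L2 f)"
    using \<open>sq_integrable k\<close> B by (intro mult_right_mono norm_abs_L2_le) auto
  finally show ?thesis .
qed

section \<open>Piecewise polynomials\<close>

lemma subspace_V_space:
  assumes "r \<ge> 1"
  shows "subspace (V_space r J)"
proof (rule subspaceI)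
  \<comment> \<open>The zero polynomial has \<open>degree\<close> 0, which must be below
    \<open>r\<close>; for \<open>r = 0\<close> the set would be empty.\<close>
  show "0 \<in> V_space r J"
    unfolding V_space_def zero_L2.abs_eq piecewise_poly_def
    using assms by (auto intro!: exI[of _ "\<lambda>x. 0"] exI[of _ "0 :: real poly"] sq_integrable_zero)
next
  fix x y assume "x \<in> V_space r J" "y \<in> V_space r J"
  then obtain f g where fg: "x = abs_L2 f" "y = abs_L2 g" "sq_integrable f" "sq_integrable g"
    "piecewise_poly r J f" "piecewise_poly r J g"
    by (auto simp: V_space_def)
  have "piecewise_poly r J (\<lambda>x. f x + g x)"
    unfolding piecewise_poly_def
  proof
    fix i assume i: "i \<in> {1..2 ^ J :: nat}"
    obtain p where p: "degree p < r"
      "\<forall>x\<in>{(real i - 1) / 2 ^ J ..< real i / 2 ^ J}. f x = poly p x"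
      using fg(5) i unfolding piecewise_poly_def by blast
    obtain q where q: "degree q < r"
      "\<forall>x\<in>{(real i - 1) / 2 ^ J ..< real i / 2 ^ J}. g x = poly q x"
      using fg(6) i unfolding piecewise_poly_def by blast
    show "\<exists>p. degree p < r \<and>
        (\<forall>x\<in>{(real i - 1) / 2 ^ J ..< real i / 2 ^ J}. f x + g x = poly p x)"
      using p q by (intro exI[of _ "p + q"]) (auto intro: degree_add_less)
  qed
  then show "x + y \<in> V_space r J"
    using fg by (auto simp: V_space_def abs_L2_add sq_integrable_add)
next
  fix c x assume "x \<in> V_space r J"
  then obtain f where f: "x = abs_L2 f" "sq_integrable f" "piecewise_poly r J f"
    by (auto simp: V_space_def)
  have "piecewise_poly r J (\<lambda>x. c * f x)"
    unfolding piecewise_poly_def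
  proof
    fix i assume i: "i \<in> {1..2 ^ J :: nat}"
    obtain p where p: "degree p < r"
      "\<forall>x\<in>{(real i - 1) / 2 ^ J ..< real i / 2 ^ J}. f x = poly p x"
      using f(3) i unfolding piecewise_poly_def by blast
    show "\<exists>p. degree p < r \<and>
        (\<forall>x\<in>{(real i - 1) / 2 ^ J ..< real i / 2 ^ J}. c * f x = poly p x)"
      using p degree_smult_le[of c p] by (intro exI[of _ "smult c p"]) auto
  qed
  then show "c *\<^sub>R x \<in> V_space r J"
    using f by (auto simp: V_space_def abs_L2_scaleR sq_integrable_scale)
qed

section \<open>Dyadic intervals and a finite spanning set\<close>

definition dyadic :: "nat \<Rightarrow> nat \<Rightarrow> real set" where
  "dyadic J i = {(real i - 1) / 2 ^ J ..< real i / 2 ^ J}"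

text \<open>The explicit index, 1-based as in \<open>piecewise_poly\<close>, yields disjointness and
  covering of the intervals at once.\<close>

lemma dyadic_iff:
  assumes "x \<ge> 0"
  shows "x \<in> dyadic J i \<longleftrightarrow> i = Suc (nat \<lfloor>2 ^ J * x\<rfloor>)"
proof -
  have "x \<in> dyadic J i \<longleftrightarrow> real i - 1 \<le> 2 ^ J * x \<and> 2 ^ J * x < real i"
    by (auto simp: dyadic_def field_simps)
  also have "\<dots> \<longleftrightarrow> \<lfloor>2 ^ J * x\<rfloor> = int i - 1"
    by (simp add: floor_eq_iff)
  also have "\<dots> \<longleftrightarrow> i = Suc (nat \<lfloor>2 ^ J * x\<rfloor>)"
  proof -
    have "0 \<le> \<lfloor>2 ^ J * x\<rfloor>"
      using assms by simp
    then show ?thesis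
      by linarith
  qed
  finally show ?thesis .
qed

lemma dyadic_index:
  fixes x :: real
  assumes "x \<in> {0..<1}"
  shows "Suc (nat \<lfloor>2 ^ J * x\<rfloor>) \<in> {1..2 ^ J}"
proof -
  have "\<lfloor>2 ^ J * x\<rfloor> < 2 ^ J"
    using assms by (simp add: floor_less_iff)
  then have "nat \<lfloor>2 ^ J * x\<rfloor> < 2 ^ J"
    using assms by (subst nat_less_iff) auto
  then show ?thesis
    by (simp add: Suc_le_eq)
qed

lemma sum_indicator_dyadic:
  assumes "x \<in> {0..<1}"
  shows "(\<Sum>i\<in>{1..2 ^ J}. indicator (dyadic J i) x * h i) = (h (Suc (nat \<lfloor>2 ^ J * x\<rfloor>)) :: real)"
proof -
  let ?i = "Suc (nat \<lfloor>2 ^ J * x\<rfloor>)"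
  have "(\<Sum>i\<in>{1..2 ^ J}. indicator (dyadic J i) x * h i)
      = (\<Sum>i\<in>{1..2 ^ J}. if i = ?i then h i else 0)"
    using assms by (intro sum.cong) (auto simp: indicator_def dyadic_iff)
  also have "\<dots> = h ?i"
    using dyadic_index[OF assms, of J] by simp
  finally show ?thesis .
qed

lemma sq_integrable_indicator_dyadic_continuous:
  assumes "continuous_on {0..1} g"
  shows "sq_integrable (\<lambda>x. indicator (dyadic J i) x * g x)"
proof -
  obtain B where B: "\<And>x. x \<in> {0..1} \<Longrightarrow> \<bar>g x\<bar> \<le> B"
    using continuous_interval_bounded[OF assms] by metis
  have [measurable]: "g \<in> borel_measurable unit_leb"
    using assms by (intro continuous_imp_measurable_on_sets_lebesgue) auto
  have [measurable]: "indicat_real (dyadic J i) \<in> borel_measurable unit_leb"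
    unfolding dyadic_def by (intro measurable_restrict_space1 borel_measurable_indicator) auto
  show ?thesis
  proof (rule sq_integrable_bounded)
    show "\<bar>indicator (dyadic J i) x * g x\<bar> \<le> B" if "x \<in> {0..1}" for x
      using B[OF that] by (auto simp: indicator_def)
  qed measurable
qed

text \<open>The generators are the \<open>r * 2 ^ J\<close> monomials of degree below
  \<open>r\<close> cut off to the dyadic intervals. Only the inclusion is recorded, which is all
  that the existence of projections asks for.\<close>

lemma V_space_subset_finite_span: "\<exists>B. finite B \<and> V_space r J \<subseteq> span B"
proof -
  define b where "b = (\<lambda>(i, k). abs_L2 (\<lambda>x. indicator (dyadic J i) x * x ^ k))"
  let ?B = "b ` ({1..2 ^ J} \<times> {..<r})"
  have "v \<in> span ?B" if v: "v \<in> V_space r J" for v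
  proof -
    obtain f where f: "v = abs_L2 f" "sq_integrable f" "piecewise_poly r J f"
      using v by (auto simp: V_space_def)
    from f(3) obtain p :: "nat \<Rightarrow> real poly"
      where p: "\<And>i. i \<in> {1..2 ^ J} \<Longrightarrow> degree (p i) < r"
        and fp: "\<And>i x. i \<in> {1..2 ^ J} \<Longrightarrow> x \<in> dyadic J i \<Longrightarrow> f x = poly (p i) x"
      unfolding piecewise_poly_def dyadic_def by metis
    define q where "q i x = indicator (dyadic J i) x * poly (p i) x" for i x
    have q: "sq_integrable (q i)" for i
      unfolding q_def
      by (intro sq_integrable_indicator_dyadic_continuous continuous_intros)
    \<comment> \<open>Equality holds only almost everywhere: at 1 every indicator vanishes, whereas
      \<open>f 1\<close> is arbitrary.\<close>
    have "AE x in unit_leb. f x = (\<Sum>i\<in>{1..2 ^ J}. q i x)"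
      using AE_unit_leb_less_1
    proof eventually_elim
      case (elim x)
      let ?i = "Suc (nat \<lfloor>2 ^ J * x\<rfloor>)"
      have "f x = poly (p ?i) x"
        using elim by (intro fp dyadic_index) (auto simp: dyadic_iff)
      then show ?case
        unfolding q_def sum_indicator_dyadic[OF elim] by simp
    qed
    then have "v = (\<Sum>i\<in>{1..2 ^ J}. abs_L2 (q i))"
      using f q by (simp add: abs_L2_cong[OF _ sq_integrable_sum] flip: abs_L2_sum)
    also have "\<dots> \<in> span ?B"
    proof (rule span_sum)
      fix i assume i: "i \<in> {1..2 ^ J :: nat}"
      have sq: "sq_integrable (\<lambda>x. indicator (dyadic J i) x * x ^ k)" for k
        by (intro sq_integrable_indicator_dyadic_continuous continuous_intros)
      have "q i = (\<lambda>x. \<Sum>k\<le>degree (p i). coeff (p i) k * (indicator (dyadic J i) x * x ^ k))"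
        by (simp add: q_def fun_eq_iff poly_altdef sum_distrib_left mult_ac)
      then have "abs_L2 (q i) = (\<Sum>k\<le>degree (p i). coeff (p i) k *\<^sub>R b (i, k))"
        using sq by (simp add: abs_L2_sum sq_integrable_scale abs_L2_scaleR b_def)
      also have "\<dots> \<in> span ?B"
        using p[OF i] i by (intro span_sum span_scale span_base imageI) auto
      finally show "abs_L2 (q i) \<in> span ?B" .
    qed
    finally show ?thesis .
  qed
  then show ?thesis
    by (intro exI[of _ ?B]) auto
qed

lemma V_space_orthogonal_decomp:
  assumes "r \<ge> 1"
  shows "\<exists>p\<in>V_space r J. \<forall>v\<in>V_space r J. orthogonal (x - p) v"
proof -
  obtain B where "finite B" "V_space r J \<subseteq> span B"
    using V_space_subset_finite_span by blast
  then show ?thesis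
    by (rule subspace_of_finite_span_orthogonal_decomp[OF subspace_V_space[OF assms]])
qed

section \<open>The projections \<open>P_op r J\<close> and approximation of Lipschitz
  functions\<close>

lemma norm_P_op_le: "r \<ge> 1 \<Longrightarrow> norm (P_op r J x) \<le> norm x"
  unfolding P_op_def
  by (intro norm_orth_proj_le subspace_V_space V_space_orthogonal_decomp)

lemma norm_minus_P_op_le:
  "r \<ge> 1 \<Longrightarrow> v \<in> V_space r J \<Longrightarrow> norm (x - P_op r J x) \<le> norm (x - v)"
  unfolding P_op_def
  by (intro norm_minus_orth_proj_le subspace_V_space V_space_orthogonal_decomp)

lemma bounded_linear_P_op: "r \<ge> 1 \<Longrightarrow> bounded_linear (P_op r J)"
  unfolding P_op_def
  by (intro bounded_linear_orth_proj subspace_V_space V_space_orthogonal_decomp)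

lemma Lipschitz_dist_V_space:
  assumes r: "r \<ge> 1" and f: "sq_integrable f"
    and C: "\<And>x y. x \<in> {0..1} \<Longrightarrow> y \<in> {0..1} \<Longrightarrow> \<bar>f x - f y\<bar> \<le> C * \<bar>x - y\<bar>"
  shows "\<exists>v\<in>V_space r J. norm (abs_L2 f - v) \<le> C / 2 ^ J"
proof -
  define g where "g x = (\<Sum>i\<in>{1..2 ^ J}. indicator (dyadic J i) x * f ((real i - 1) / 2 ^ J))" for x
  have g: "sq_integrable g"
    unfolding g_def
    by (intro sq_integrable_sum sq_integrable_indicator_dyadic_continuous continuous_intros) auto
  have "piecewise_poly r J g"
    unfolding piecewise_poly_def dyadic_def[symmetric]
  proof
    fix i assume i: "i \<in> {1..2 ^ J :: nat}"
    have "g x = f ((real i - 1) / 2 ^ J)" if x: "x \<in> dyadic J i" for x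
    proof -
      have "0 \<le> (real i - 1) / 2 ^ J" "real i / 2 ^ J \<le> 1"
        using i by (auto simp: field_simps)
      then have x01: "x \<in> {0..<1}"
        using x unfolding dyadic_def atLeastLessThan_iff by linarith
      then have "Suc (nat \<lfloor>2 ^ J * x\<rfloor>) = i"
        using x by (simp add: dyadic_iff)
      then show ?thesis
        unfolding g_def sum_indicator_dyadic[OF x01] by simp
    qed
    then show "\<exists>p. degree p < r \<and> (\<forall>x\<in>dyadic J i. g x = poly p x)"
      using r by (intro exI[of _ "[:f ((real i - 1) / 2 ^ J):]"]) auto
  qed
  then have "abs_L2 g \<in> V_space r J"
    using g by (auto simp: V_space_def)
  moreover have "norm (abs_L2 f - abs_L2 g) \<le> C / 2 ^ J"
    unfolding abs_L2_diff[OF f g]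
  proof (rule norm_abs_L2_le)
    show "sq_integrable (\<lambda>x. f x - g x)"
      using sq_integrable_add[OF f sq_integrable_scale[OF g, of "-1"]] by simp
    fix x :: real assume x: "x \<in> {0..<1}"
    define i where "i = Suc (nat \<lfloor>2 ^ J * x\<rfloor>)"
    \<comment> \<open>As \<open>i\<close> is 1-based, \<open>y\<close> is the left endpoint of the
      dyadic interval containing \<open>x\<close>, so \<open>x - y\<close> is below the mesh
      width.\<close>
    define y where "y = (real i - 1) / 2 ^ J"
    have xi: "x \<in> dyadic J i"
      using x by (simp add: dyadic_iff i_def)
    then have y: "y \<le> x" "x < y + 1 / 2 ^ J" "0 \<le> y"
      by (auto simp: y_def dyadic_def i_def add.commute simp flip: add_divide_distrib)
    have C0: "0 \<le> C"
      using C[of 0 1] by auto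
    have "\<bar>f x - g x\<bar> = \<bar>f x - f y\<bar>"
      unfolding g_def sum_indicator_dyadic[OF x] by (simp add: y_def i_def)
    also have "\<dots> \<le> C * \<bar>x - y\<bar>"
      using x y by (intro C) auto
    also have "\<dots> \<le> C * (1 / 2 ^ J)"
      using y C0 by (intro mult_left_mono) auto
    finally show "\<bar>f x - g x\<bar> \<le> C / 2 ^ J"
      by simp
  qed
  ultimately show ?thesis
    by blast
qed

section \<open>The integral operator\<close>

text \<open>Mean value estimate with a derivative that is continuous, hence bounded, on
  \<open>{-1..1}\<close>, the range of \<open>z - \<xi>\<close> for arguments in the unit
  interval.\<close>

lemma kern_Lipschitz:
  "\<exists>C. \<forall>x\<in>{-1..1}. \<forall>y\<in>{-1..1}. \<bar>kern \<sigma> L U x \<tau> - kern \<sigma> L U y \<tau>\<bar> \<le> C * \<bar>x - y\<bar>"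
proof -
  \<comment> \<open>Multiplication by the constant \<open>b\<close> replaces division, so the
    derivative rules see only products.\<close>
  define a b t where "a = \<theta>_of L U / sqrt (4 * pi * csq_of \<sigma> * \<tau>)"
    and "b = inverse (4 * csq_of \<sigma> * \<tau>)" and "t = \<theta>_of L U"
  define k' where "k' z = a * (exp (- (t * z)\<^sup>2 * b) * (- (2 * (t * z) * t) * b))" for z
  have k: "kern \<sigma> L U z \<tau> = a * exp (- (t * z)\<^sup>2 * b)" for z
    by (simp only: kern_def a_def b_def t_def divide_inverse)
  have "continuous_on {-1..1} k'"
    unfolding k'_def by (intro continuous_intros)
  then obtain C where C: "\<And>z. z \<in> {-1..1} \<Longrightarrow> \<bar>k' z\<bar> \<le> C"
    using continuous_interval_bounded by metis
  have "norm (kern \<sigma> L U x \<tau> - kern \<sigma> L U y \<tau>) \<le> C * norm (x - y)"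
    if "x \<in> {-1..1}" "y \<in> {-1..1}" for x y
  proof (rule field_differentiable_bound)
    show "((\<lambda>z. kern \<sigma> L U z \<tau>) has_field_derivative k' z) (at z within {-1..1})" for z
      unfolding k k'_def by (auto intro!: derivative_eq_intros)
  qed (use that C in auto)
  then show ?thesis
    unfolding real_norm_def by blast
qed

context
  fixes \<sigma> L U \<tau> :: real
begin

abbreviation K_fun :: "(real \<Rightarrow> real) \<Rightarrow> real \<Rightarrow> real" where
  "K_fun f z \<equiv> \<integral>\<xi>. kern \<sigma> L U (z - \<xi>) \<tau> * f \<xi> \<partial>unit_leb"

lemma K_op_abs_L2: "sq_integrable f \<Longrightarrow> K_op \<sigma> L U \<tau> (abs_L2 f) = abs_L2 (K_fun f)"
  by (simp add: K_op.abs_eq)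

lemma integrable_kern_mult:
  assumes "sq_integrable f"
  shows "integrable unit_leb (\<lambda>\<xi>. kern \<sigma> L U (z - \<xi>) \<tau> * f \<xi>)"
  by (intro sq_integrable_mult assms sq_integrable_continuous continuous_intros)

text \<open>With \<open>B\<close> a bound for the kernel, \<open>K_fun f\<close> is at most
  \<open>B * norm (abs_L2 f)\<close> at every point of the unit interval, and a pointwise bound
  there also bounds the L2 norm.\<close>

lemma norm_K_op_le: "\<exists>B\<ge>0. \<forall>x. norm (K_op \<sigma> L U \<tau> x) \<le> B * norm x"
proof -
  obtain B where B: "\<And>z \<xi>. z \<in> {0..1} \<Longrightarrow> \<xi> \<in> {0..1} \<Longrightarrow> \<bar>kern \<sigma> L U (z - \<xi>) \<tau>\<bar> \<le> B"
    using kern_bounded by metis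
  have "norm (K_op \<sigma> L U \<tau> x) \<le> B * norm x" for x
  proof -
    obtain f where f: "sq_integrable f" "x = abs_L2 f"
      by (rule L2_cases)
    show ?thesis
      unfolding f(2) K_op_abs_L2[OF f(1)]
      using B f(1)
      by (intro norm_abs_L2_le sq_integrable_kern_integral integral_mult_le_norm kern_measurable) auto
  qed
  moreover have "0 \<le> B"
    using B[of 0 0] by auto
  ultimately show ?thesis
    by blast
qed

lemma bounded_linear_K_op: "bounded_linear (K_op \<sigma> L U \<tau>)"
proof -
  obtain B where B: "\<And>x. norm (K_op \<sigma> L U \<tau> x) \<le> B * norm x"
    using norm_K_op_le by blast
  show ?thesis
  proof (rule bounded_linear_intro)
    fix x y :: L2 and c :: real
    obtain f g where fg: "sq_integrable f" "x = abs_L2 f" "sq_integrable g" "y = abs_L2 g"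
      by (metis L2_cases)
    show "K_op \<sigma> L U \<tau> (x + y) = K_op \<sigma> L U \<tau> x + K_op \<sigma> L U \<tau> y"
      using fg by (simp add: abs_L2_add K_op_abs_L2 sq_integrable_add sq_integrable_kern_integral
          distrib_left integrable_kern_mult)
    show "K_op \<sigma> L U \<tau> (c *\<^sub>R x) = c *\<^sub>R K_op \<sigma> L U \<tau> x"
      using fg by (simp add: abs_L2_scaleR K_op_abs_L2 sq_integrable_scale
          sq_integrable_kern_integral mult.left_commute)
    show "norm (K_op \<sigma> L U \<tau> x) \<le> norm x * B"
      using B[of x] by (simp add: mult.commute)
  qed
qed

text \<open>The Lipschitz constant of the kernel passes through the integral. \<open>C\<close> is
  fixed before \<open>f\<close> because an operator norm estimate needs it uniform in
  \<open>f\<close>.\<close>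

lemma K_fun_Lipschitz:
  "\<exists>C\<ge>0. \<forall>f x y. sq_integrable f \<longrightarrow> x \<in> {0..1} \<longrightarrow> y \<in> {0..1} \<longrightarrow>
     \<bar>K_fun f x - K_fun f y\<bar> \<le> C * norm (abs_L2 f) * \<bar>x - y\<bar>"
proof -
  obtain C where C: "\<And>x y. x \<in> {-1..1} \<Longrightarrow> y \<in> {-1..1} \<Longrightarrow>
      \<bar>kern \<sigma> L U x \<tau> - kern \<sigma> L U y \<tau>\<bar> \<le> C * \<bar>x - y\<bar>"
    using kern_Lipschitz by metis
  have "\<bar>K_fun f x - K_fun f y\<bar> \<le> C * norm (abs_L2 f) * \<bar>x - y\<bar>"
    if f: "sq_integrable f" and xy: "x \<in> {0..1}" "y \<in> {0..1}" for f x y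
  proof -
    have "K_fun f x - K_fun f y
        = (\<integral>\<xi>. (kern \<sigma> L U (x - \<xi>) \<tau> - kern \<sigma> L U (y - \<xi>) \<tau>) * f \<xi> \<partial>unit_leb)"
      by (simp add: left_diff_distrib integrable_kern_mult f)
    also have "\<bar>\<dots>\<bar> \<le> C * \<bar>x - y\<bar> * norm (abs_L2 f)"
    proof (rule integral_mult_le_norm[OF f])
      show "(\<lambda>\<xi>. kern \<sigma> L U (x - \<xi>) \<tau> - kern \<sigma> L U (y - \<xi>) \<tau>) \<in> borel_measurable unit_leb"
        by (intro borel_measurable_diff kern_measurable)
      show "\<bar>kern \<sigma> L U (x - \<xi>) \<tau> - kern \<sigma> L U (y - \<xi>) \<tau>\<bar> \<le> C * \<bar>x - y\<bar>"
        if "\<xi> \<in> {0..1}" for \<xi>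
        using C[of "x - \<xi>" "y - \<xi>"] that xy by auto
    qed
    finally show ?thesis
      by (simp add: mult_ac)
  qed
  moreover have "0 \<le> C"
    using C[of 0 1] by auto
  ultimately show ?thesis
    by blast
qed

lemma bounded_linear_PK_op:
  assumes "r \<ge> 1"
  shows "bounded_linear (PK_op \<sigma> L U \<tau> r J)"
  unfolding PK_op_def comp_def
  by (rule bounded_linear_compose[OF bounded_linear_P_op[OF assms] bounded_linear_K_op])

text \<open>\<open>K_op\<close> maps into Lipschitz functions with constant
  \<open>C * norm x\<close>, and the projection is no worse than the approximating step function.
  \<open>C\<close> depends on neither \<open>J\<close> nor \<open>x\<close>, so the operator norm of
  the error decays like \<open>1 / 2 ^ J\<close>.\<close>

lemma norm_PK_op_minus_K_op_le:
  assumes r: "r \<ge> 1"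
  shows "\<exists>C\<ge>0. \<forall>J x. norm (PK_op \<sigma> L U \<tau> r J x - K_op \<sigma> L U \<tau> x) \<le> C / 2 ^ J * norm x"
proof -
  obtain C where C: "0 \<le> C" "\<And>f x y. sq_integrable f \<Longrightarrow> x \<in> {0..1} \<Longrightarrow> y \<in> {0..1} \<Longrightarrow>
     \<bar>K_fun f x - K_fun f y\<bar> \<le> C * norm (abs_L2 f) * \<bar>x - y\<bar>"
    using K_fun_Lipschitz by blast
  have "norm (PK_op \<sigma> L U \<tau> r J x - K_op \<sigma> L U \<tau> x) \<le> C / 2 ^ J * norm x" for J x
  proof -
    obtain f where f: "sq_integrable f" "x = abs_L2 f"
      by (rule L2_cases)
    obtain v where v: "v \<in> V_space r J"
      "norm (K_op \<sigma> L U \<tau> x - v) \<le> C * norm x / 2 ^ J"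
      using Lipschitz_dist_V_space[OF r sq_integrable_kern_integral[OF f(1)] C(2)[OF f(1)]]
      unfolding f(2) K_op_abs_L2[OF f(1)] by blast
    have "norm (PK_op \<sigma> L U \<tau> r J x - K_op \<sigma> L U \<tau> x)
        = norm (K_op \<sigma> L U \<tau> x - P_op r J (K_op \<sigma> L U \<tau> x))"
      by (simp add: PK_op_def norm_minus_commute)
    also have "\<dots> \<le> norm (K_op \<sigma> L U \<tau> x - v)"
      using r v(1) by (rule norm_minus_P_op_le)
    finally show ?thesis
      using v(2) by simp
  qed
  with C(1) show ?thesis
    by blast
qed

end

section \<open>Powers of operators\<close>

lemma bounded_linear_funpow:
  fixes A :: "'a::real_normed_vector \<Rightarrow> 'a"
  assumes "bounded_linear A"
  shows "bounded_linear (A ^^ m)"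
proof (induction m)
  case 0
  show ?case by (simp add: id_def bounded_linear_ident)
next
  case (Suc m)
  show ?case
    using bounded_linear_compose[OF assms Suc] by (simp add: comp_def)
qed

lemma norm_funpow_le:
  fixes A :: "'a::real_normed_vector \<Rightarrow> 'a"
  assumes "0 \<le> k" "\<And>x. norm (A x) \<le> k * norm x"
  shows "norm ((A ^^ m) x) \<le> k ^ m * norm x"
proof (induction m)
  case (Suc m)
  have "norm ((A ^^ Suc m) x) \<le> k * norm ((A ^^ m) x)"
    using assms(2) by simp
  also have "\<dots> \<le> k * (k ^ m * norm x)"
    using Suc assms(1) by (rule mult_left_mono)
  finally show ?case
    by (simp add: mult.assoc)
qed auto

lemma norm_funpow_diff_le:
  fixes A B :: "'a::real_normed_vector \<Rightarrow> 'a"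
  assumes A: "bounded_linear A" and k: "0 \<le> k" and e: "0 \<le> e"
    and Ak: "\<And>x. norm (A x) \<le> k * norm x" and Bk: "\<And>x. norm (B x) \<le> k * norm x"
    and AB: "\<And>x. norm (A x - B x) \<le> e * norm x"
  shows "norm ((A ^^ m) x - (B ^^ m) x) \<le> real m * k ^ (m - 1) * e * norm x"
proof (induction m)
  case (Suc m)
  \<comment> \<open>Telescoping: one factor \<open>A\<close> is split off on the left, and
    \<open>A ((B ^^ m) x)\<close> is subtracted and added.\<close>
  have "(A ^^ Suc m) x - (B ^^ Suc m) x
      = A ((A ^^ m) x - (B ^^ m) x) + (A ((B ^^ m) x) - B ((B ^^ m) x))"
    by (simp add: linear_diff[OF bounded_linear.linear[OF A]])
  also have "norm \<dots> \<le> norm (A ((A ^^ m) x - (B ^^ m) x)) + norm (A ((B ^^ m) x) - B ((B ^^ m) x))"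
    by (rule norm_triangle_ineq)
  also have "\<dots> \<le> k * norm ((A ^^ m) x - (B ^^ m) x) + e * norm ((B ^^ m) x)"
    by (intro add_mono Ak AB)
  also have "\<dots> \<le> k * (real m * k ^ (m - 1) * e * norm x) + e * (k ^ m * norm x)"
    using Suc k e norm_funpow_le[OF k Bk] by (intro add_mono mult_left_mono) auto
  \<comment> \<open>The case split handles truncated subtraction: for \<open>m = 0\<close> the
    exponent \<open>m - 1\<close> is 0, but the factor \<open>real m\<close> removes that
    term.\<close>
  also have "\<dots> = real (Suc m) * k ^ (Suc m - 1) * e * norm x"
    by (cases m) (simp_all add: algebra_simps)
  finally show ?case .
qed simp

section \<open>Recursions as operator powers, and the limit\<close>

lemma f_seq_eq_funpow: "f_seq rh \<sigma> L U E \<tau> m = (K_op \<sigma> L U \<tau> ^^ m) (f_init rh \<sigma> L U E)"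
  by (induction m) auto

lemma f_approx_eq_funpow:
  "f_approx rh \<sigma> L U E \<tau> r J m = (PK_op \<sigma> L U \<tau> r J ^^ m) (f_init rh \<sigma> L U E)"
  by (induction m) auto

theorem mainTheorem1:
  fixes rh \<sigma> L U E T \<tau> :: real and M r :: nat
  assumes "\<sigma> > 0" and "0 < L" and "L < U" and "E > 0" and "T > 0"
    and "M \<ge> 1" and "\<tau> = T / real M" and "r \<ge> 1"
  shows "\<forall>m\<in>{1..M}.
     (\<forall>J. norm (f_approx rh \<sigma> L U E \<tau> r J m - f_seq rh \<sigma> L U E \<tau> m)
            \<le> onorm (\<lambda>g. (PK_op \<sigma> L U \<tau> r J ^^ m) g - (K_op \<sigma> L U \<tau> ^^ m) g)
                * norm (f_init rh \<sigma> L U E)) \<and>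
     (\<lambda>J. onorm (\<lambda>g. (PK_op \<sigma> L U \<tau> r J ^^ m) g - (K_op \<sigma> L U \<tau> ^^ m) g)) \<longlonglongrightarrow> 0 \<and>
     (\<lambda>J. norm (f_approx rh \<sigma> L U E \<tau> r J m - f_seq rh \<sigma> L U E \<tau> m)) \<longlonglongrightarrow> 0"
proof
  fix m
  let ?K = "K_op \<sigma> L U \<tau>" and ?PK = "PK_op \<sigma> L U \<tau> r" and ?f = "f_init rh \<sigma> L U E"
  let ?D = "\<lambda>J g. (?PK J ^^ m) g - (?K ^^ m) g"
  let ?err = "\<lambda>J. norm (f_approx rh \<sigma> L U E \<tau> r J m - f_seq rh \<sigma> L U E \<tau> m)"
  \<comment> \<open>Bounded linearity makes \<open>onorm (?D J)\<close> a genuine bound for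
    \<open>?D J\<close>. Both recursions start from the same \<open>?f\<close>, so the error is
    exactly \<open>?D J ?f\<close>.\<close>
  have D: "bounded_linear (?D J)" for J
    using assms(8)
    by (intro bounded_linear_sub bounded_linear_funpow bounded_linear_PK_op bounded_linear_K_op)
  have err: "?err J \<le> onorm (?D J) * norm ?f" for J
    unfolding f_seq_eq_funpow f_approx_eq_funpow by (rule onorm[OF D])
  obtain k where k: "0 \<le> k" "\<And>x. norm (?K x) \<le> k * norm x"
    using norm_K_op_le by metis
  obtain C where C: "0 \<le> C" "\<And>J x. norm (?PK J x - ?K x) \<le> C / 2 ^ J * norm x"
    using norm_PK_op_minus_K_op_le[OF assms(8)] by metis
  \<comment> \<open>The projection does not increase norms, so the single constant \<open>k\<close>
    serves \<open>?K\<close> and every \<open>?PK J\<close>, uniformly in \<open>J\<close>.\<close>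
  have "norm (?PK J x) \<le> k * norm x" for J x
    using norm_P_op_le[OF assms(8), of J "?K x"] k(2)[of x] by (simp add: PK_op_def)
  then have "norm (?D J x) \<le> real m * k ^ (m - 1) * (C / 2 ^ J) * norm x" for J x
    using assms(8) k C by (intro norm_funpow_diff_le bounded_linear_PK_op) auto
  then have upper: "onorm (?D J) \<le> real m * k ^ (m - 1) * (C / 2 ^ J)" for J
    using k C by (intro onorm_bound) auto
  have "(\<lambda>J. C / 2 ^ J) \<longlonglongrightarrow> 0"
    by (rule LIMSEQ_divide_realpow_zero) simp
  then have "(\<lambda>J. real m * k ^ (m - 1) * (C / 2 ^ J)) \<longlonglongrightarrow> 0"
    by (rule tendsto_mult_right_zero)
  \<comment> \<open>Squeeze: \<open>onorm (?D J)\<close> is nonnegative and lies below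
    \<open>upper\<close>, where only \<open>C / 2 ^ J\<close> varies with \<open>J\<close>.\<close>
  then have lim: "(\<lambda>J. onorm (?D J)) \<longlonglongrightarrow> 0"
    by (rule Lim_null_comparison[rotated])
      (intro always_eventually allI, simp only: real_norm_def abs_of_nonneg[OF onorm_pos_le[OF D]] upper)
  then have "(\<lambda>J. onorm (?D J) * norm ?f) \<longlonglongrightarrow> 0"
    by (rule tendsto_mult_left_zero)
  then have "?err \<longlonglongrightarrow> 0"
    by (rule Lim_null_comparison[rotated])
      (intro always_eventually allI, simp only: real_norm_def abs_norm_cancel err)
  with err lim show "(\<forall>J. ?err J \<le> onorm (?D J) * norm ?f) \<and>
      (\<lambda>J. onorm (?D J)) \<longlonglongrightarrow> 0 \<and> ?err \<longlonglongrightarrow> 0"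
    by blast
qed

end
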